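(* For every infinite Tychonoff space $X$, $$d(O(\beta X))\le d(X),\quad d(O_\tau(X))\le d(X),\quad d(O_R(X))\le d(X),\quad d(O_\beta(X))\le d(X).$$
   Context: For a compact Hausdorff space $K$, $C(K)$ is the space of continuous real-valued functions on $K$ with the pointwise order, and $c_K$ denotes the constant function with value $c\in\mathbb{R}$. $O(K)$ is the set of all functionals $\mu: C(K)\to\mathbb{R}$ (not necessarily linear) that are order-preserving ($\varphi\le\psi$ implies $\mu(\varphi)\le\mu(\psi)$), weakly additive ($\mu(\varphi+c_K)=\mu(\varphi)+c\,\mu(1_K)$ for all $\varphi\in C(K)$, $c\in\mathbb{R}$) and normed ($\mu(1_K)=1$). For a closed subset $A\subset K$, a functional $\mu\in O(K)$ is supported on $A$ if $\mu\in O(A)$, where $O(A)$ is identified with a subset of $O(K)$ via $\nu\mapsto(\varphi\mapsto\nu(\varphi|_A))$; the support $\operatorname{supp}\mu$ is the intersection of all closed $A\subset K$ on which $\mu$ is supported. For a Tychonoff space $X$, $\beta X$ is its Stone-Čech compactification, and: - $O_\tau(X)$ is the set of all $\mu\in O(\beta X)$ that are $\tau$-smooth, i.e. $\mu(\varphi_\alpha)\to 0$ for each net $\{\varphi_\alpha\}\subset C(\beta X)$ that decreases monotonically to zero on $X$ (for every $x\in X$: $\varphi_\alpha(x)\ge\varphi_{\beta}(x)$ whenever $\beta\succ\alpha$, and $\lim_\alpha\varphi_\alpha(x)=0$); - $O_R(X)$ is the set of all $\mu\in O(\beta X)$ that are Radon, i.e. $\mu(\varphi_\alpha)\to 0$ for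 each (norm-)bounded net $\{\varphi_\alpha\}\subset C(\beta X)$ which converges to zero uniformly on compact subsets of $X$; - $O_\beta(X)=\{\mu\in O(\beta X): \operatorname{supp}\mu\subset X\}$. All these spaces carry the topology of pointwise convergence on $C(\beta X)$. The density $d(X)$ of a topological space $X$ is the least cardinality of a dense subset of $X$. *)

theory Defs
  imports "HOL-Analysis.Analysis"
begin

unbundle cardinal_syntax

section \<open>Density of a topological space\<close>

definition dense_in :: "'a topology \<Rightarrow> 'a set \<Rightarrow> bool" where
  "dense_in Y D \<longleftrightarrow> D \<subseteq> topspace Y \<and> Y closure_of D = topspace Y"

definition top_density :: "'a topology \<Rightarrow> 'a rel" where
  "top_density Y = |SOME D. dense_in Y D \<and> (\<forall>D'. dense_in Y D' \<longrightarrow> |D| \<le>o |D'| )|"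

lemma top_density_attained:
  "\<exists>D. dense_in Y D \<and> top_density Y = |D| \<and> (\<forall>D'. dense_in Y D' \<longrightarrow> |D| \<le>o |D'| )"
proof -
  have "dense_in Y (topspace Y)"
    by (simp add: dense_in_def)
  then have "\<exists>r \<in> card_of ` Collect (dense_in Y). \<forall>r' \<in> card_of ` Collect (dense_in Y). r \<le>o r'"
    by (intro exists_minim_Card_order) (auto simp: card_of_Card_order)
  then have "\<exists>D. dense_in Y D \<and> (\<forall>D'. dense_in Y D' \<longrightarrow> |D| \<le>o |D'| )"
    by auto
  from someI_ex[OF this] show ?thesis
    unfolding top_density_def by blast
qed


section \<open>Order-preserving, weakly additive, normed functionals\<close>

text \<open>A continuous function on the space \<open>K\<close> is represented by the HOL function that is
  \<^term>\<open>undefined\<close> off \<^term>\<open>topspace K\<close>; a functional on \<open>C(K)\<close> is \<^term>\<open>undefined\<close>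
  off \<open>C(K)\<close>. So distinct HOL objects are distinct mathematical objects.\<close>

definition C_space :: "'b topology \<Rightarrow> ('b \<Rightarrow> real) set" where
  "C_space K = {f. continuous_map K euclideanreal f} \<inter> extensional (topspace K)"

definition const_fun :: "'b topology \<Rightarrow> real \<Rightarrow> 'b \<Rightarrow> real" where
  "const_fun K c = (\<lambda>x\<in>topspace K. c)"

definition add_fun :: "'b topology \<Rightarrow> ('b \<Rightarrow> real) \<Rightarrow> ('b \<Rightarrow> real) \<Rightarrow> 'b \<Rightarrow> real" where
  "add_fun K f g = (\<lambda>x\<in>topspace K. f x + g x)"

definition order_preserving :: "'b topology \<Rightarrow> (('b \<Rightarrow> real) \<Rightarrow> real) \<Rightarrow> bool" where
  "order_preserving K \<mu> \<longleftrightarrow>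
     (\<forall>f\<in>C_space K. \<forall>g\<in>C_space K. (\<forall>x\<in>topspace K. f x \<le> g x) \<longrightarrow> \<mu> f \<le> \<mu> g)"

definition weakly_additive :: "'b topology \<Rightarrow> (('b \<Rightarrow> real) \<Rightarrow> real) \<Rightarrow> bool" where
  "weakly_additive K \<mu> \<longleftrightarrow>
     (\<forall>f\<in>C_space K. \<forall>c. \<mu> (add_fun K f (const_fun K c)) = \<mu> f + c * \<mu> (const_fun K 1))"

definition normed :: "'b topology \<Rightarrow> (('b \<Rightarrow> real) \<Rightarrow> real) \<Rightarrow> bool" where
  "normed K \<mu> \<longleftrightarrow> \<mu> (const_fun K 1) = 1"

definition O_set :: "'b topology \<Rightarrow> (('b \<Rightarrow> real) \<Rightarrow> real) set" where
  "O_set K = {\<mu> \<in> extensional (C_space K).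
     order_preserving K \<mu> \<and> weakly_additive K \<mu> \<and> normed K \<mu>}"

text \<open>\<open>O_embed K A\<close> is the map along which \<open>O(A)\<close> is identified with a subset of \<open>O(K)\<close>.\<close>

definition O_embed :: "'b topology \<Rightarrow> 'b set \<Rightarrow> (('b \<Rightarrow> real) \<Rightarrow> real) \<Rightarrow> (('b \<Rightarrow> real) \<Rightarrow> real)" where
  "O_embed K A \<nu> = (\<lambda>f\<in>C_space K. \<nu> (restrict f A))"

definition supported_on :: "'b topology \<Rightarrow> (('b \<Rightarrow> real) \<Rightarrow> real) \<Rightarrow> 'b set \<Rightarrow> bool" where
  "supported_on K \<mu> A \<longleftrightarrow> \<mu> \<in> O_embed K A ` O_set (subtopology K A)"

definition supp :: "'b topology \<Rightarrow> (('b \<Rightarrow> real) \<Rightarrow> real) \<Rightarrow> 'b set" where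
  "supp K \<mu> = \<Inter>{A. closedin K A \<and> supported_on K \<mu> A}"

text \<open>The topology of pointwise convergence on \<open>C(K)\<close>, on a set \<open>S\<close> of functionals.\<close>

definition pointwise_topology ::
    "'b topology \<Rightarrow> (('b \<Rightarrow> real) \<Rightarrow> real) set \<Rightarrow> (('b \<Rightarrow> real) \<Rightarrow> real) topology" where
  "pointwise_topology K S = subtopology (product_topology (\<lambda>_. euclideanreal) (C_space K)) S"

lemma topspace_pointwise_topology:
  assumes "S \<subseteq> O_set K"
  shows "topspace (pointwise_topology K S) = S"
  using assms by (auto simp: pointwise_topology_def O_set_def PiE_def)

lemma supported_on_topspace:
  assumes "\<mu> \<in> O_set K"
  shows "supported_on K \<mu> (topspace K)"
proof -
  have "O_embed K (topspace K) \<mu> = \<mu>"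
    using assms
    by (auto simp: O_embed_def O_set_def C_space_def restrict_def extensional_def fun_eq_iff
        intro!: arg_cong[where f = \<mu>])
  then show ?thesis
    using assms unfolding supported_on_def by (metis imageI subtopology_topspace)
qed


section \<open>The Stone-Cech compactification\<close>

text \<open>The closure of the image of \<open>X\<close> in the Tychonoff cube that has one coordinate for each
  continuous map from \<open>X\<close> to the unit interval.\<close>

type_synonym 'a sc_point = "('a \<Rightarrow> real) \<Rightarrow> real"

definition unit_maps :: "'a topology \<Rightarrow> ('a \<Rightarrow> real) set" where
  "unit_maps X = {f. continuous_map X (top_of_set {0..1}) f} \<inter> extensional (topspace X)"

definition unit_cube :: "'a topology \<Rightarrow> 'a sc_point topology" where
  "unit_cube X = product_topology (\<lambda>_. top_of_set {0..1}) (unit_maps X)"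

definition sc_embed :: "'a topology \<Rightarrow> 'a \<Rightarrow> 'a sc_point" where
  "sc_embed X x = (\<lambda>f\<in>unit_maps X. f x)"

definition stone_cech :: "'a topology \<Rightarrow> 'a sc_point topology" where
  "stone_cech X = subtopology (unit_cube X) (unit_cube X closure_of (sc_embed X ` topspace X))"

lemma unit_cube_compact: "compact_space (unit_cube X)"
  unfolding unit_cube_def
  using compact_space_product_topology compact_space_subtopology compactin_euclidean_iff by blast

lemma unit_cube_Hausdorff: "Hausdorff_space (unit_cube X)"
  unfolding unit_cube_def
  using Hausdorff_space_euclidean Hausdorff_space_product_topology Hausdorff_space_subtopology
  by blast

lemma stone_cech_compact: "compact_space (stone_cech X)"
  unfolding stone_cech_def
  by (meson closedin_closure_of closedin_compact_space compact_space_subtopology unit_cube_compact)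

lemma stone_cech_Hausdorff: "Hausdorff_space (stone_cech X)"
  unfolding stone_cech_def by (simp add: Hausdorff_space_subtopology unit_cube_Hausdorff)

lemma continuous_map_sc_embed_cube: "continuous_map X (unit_cube X) (sc_embed X)"
  unfolding unit_cube_def sc_embed_def
  by (auto simp: continuous_map_componentwise unit_maps_def restrict_def extensional_def)

lemma sc_embed_image_subset: "sc_embed X ` topspace X \<subseteq> topspace (unit_cube X)"
  using continuous_map_sc_embed_cube by (rule continuous_map_image_subset_topspace)

lemma sc_embed_dense: "dense_in (stone_cech X) (sc_embed X ` topspace X)"
proof -
  have "sc_embed X ` topspace X \<subseteq> unit_cube X closure_of (sc_embed X ` topspace X)"
    by (rule closure_of_subset[OF sc_embed_image_subset])
  then show ?thesis
    using closure_of_subset_topspace[of "unit_cube X" "sc_embed X ` topspace X"]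
    by (auto simp: dense_in_def stone_cech_def closure_of_subtopology Int_absorb1 Int_absorb2)
qed

lemma sc_embed_embedding_cube:
  assumes "completely_regular_space X" "Hausdorff_space X"
  shows "embedding_map X (unit_cube X) (sc_embed X)"
proof -
  have "bounded (f ` topspace X)" if "f \<in> topspace X \<rightarrow> {0..1}" for f :: "'a \<Rightarrow> real"
    using that by (intro bounded_subset[OF bounded_closed_interval[of 0 1]]) auto
  then have "mspace (submetric (cfunspace X euclidean_metric) {f. f \<in> topspace X \<rightarrow> {0..1::real}})
      = unit_maps X"
    by (auto simp: unit_maps_def continuous_map_in_subtopology)
  with completely_regular_space_cube_embedding_explicit[OF assms] show ?thesis
    by (simp add: unit_cube_def sc_embed_def[abs_def])
qed

lemma sc_embed_embedding:
  assumes "completely_regular_space X" "Hausdorff_space X"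
  shows "embedding_map X (stone_cech X) (sc_embed X)"
  unfolding stone_cech_def
  by (simp add: embedding_map_in_subtopology sc_embed_embedding_cube[OF assms]
      closure_of_subset[OF sc_embed_image_subset] image_subset_iff_funcset[symmetric])

lemma stone_cech_extension:
  fixes X :: "'a topology" and Z :: "'b topology"
  assumes Z: "compact_space Z" "Hausdorff_space Z" and f: "continuous_map X Z f"
  shows "\<exists>g. continuous_map (stone_cech X) Z g \<and> (\<forall>x\<in>topspace X. g (sc_embed X x) = f x)"
proof -
  have crZ: "completely_regular_space Z"
    using Z compact_Hausdorff_or_regular_imp_normal_space normal_imp_completely_regular_space
    by blast
  have emb: "embedding_map Z (unit_cube Z) (sc_embed Z)"
    by (rule sc_embed_embedding_cube[OF crZ Z(2)])
  then obtain r where r: "homeomorphic_maps Z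
      (subtopology (unit_cube Z) (sc_embed Z ` topspace Z)) (sc_embed Z) r"
    by (auto simp: embedding_map_def homeomorphic_map_maps)
  define pull where "pull h = restrict (h \<circ> f) (topspace X)" for h :: "'b \<Rightarrow> real"
  have pull: "pull h \<in> unit_maps X" if "h \<in> unit_maps Z" for h
  proof -
    have "continuous_map X (top_of_set {0..1}) (h \<circ> f)"
      using that by (intro continuous_map_compose[OF f]) (simp add: unit_maps_def)
    then have "continuous_map X (top_of_set {0..1}) (pull h)"
      by (rule continuous_map_eq) (simp add: pull_def)
    then show ?thesis
      by (simp add: unit_maps_def pull_def)
  qed
  define G where "G p = (\<lambda>h\<in>unit_maps Z. p (pull h))" for p :: "'a sc_point"
  have contG: "continuous_map (unit_cube X) (unit_cube Z) G"
    unfolding unit_cube_def continuous_map_componentwise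
  proof (intro conjI ballI)
    show "G ` topspace (product_topology (\<lambda>_. top_of_set {0..1}) (unit_maps X))
        \<subseteq> extensional (unit_maps Z)"
      by (auto simp: G_def)
    fix h assume h: "h \<in> unit_maps Z"
    have "continuous_map (product_topology (\<lambda>_. top_of_set {0..1::real}) (unit_maps X))
        (top_of_set {0..1}) (\<lambda>p. p (pull h))"
      by (rule continuous_map_product_projection[OF pull[OF h]])
    then show "continuous_map (product_topology (\<lambda>_. top_of_set {0..1::real}) (unit_maps X))
        (top_of_set {0..1}) (\<lambda>p. G p h)"
      using h by (simp add: G_def)
  qed
  have fim: "f x \<in> topspace Z" if "x \<in> topspace X" for x
    using f that by (auto simp: continuous_map_def)
  have G_embed: "G (sc_embed X x) = sc_embed Z (f x)" if "x \<in> topspace X" for x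
    using that pull by (auto simp: G_def sc_embed_def fun_eq_iff) (simp add: pull_def)
  have closed: "closedin (unit_cube Z) (sc_embed Z ` topspace Z)"
    by (intro compactin_imp_closedin[OF unit_cube_Hausdorff]
        image_compactin[OF _ continuous_map_sc_embed_cube])
      (use Z(1) in \<open>simp add: compact_space_def\<close>)
  have "G ` (unit_cube X closure_of (sc_embed X ` topspace X))
      \<subseteq> unit_cube Z closure_of (G ` sc_embed X ` topspace X)"
    by (rule continuous_map_image_closure_subset[OF contG])
  also have "\<dots> \<subseteq> sc_embed Z ` topspace Z"
    by (rule closure_of_minimal[OF _ closed]) (auto simp: G_embed fim)
  finally have "continuous_map (stone_cech X)
      (subtopology (unit_cube Z) (sc_embed Z ` topspace Z)) G"
    using contG unfolding stone_cech_def
    by (auto simp: continuous_map_in_subtopology continuous_map_from_subtopology)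
  then have "continuous_map (stone_cech X) Z (r \<circ> G)"
    by (rule continuous_map_compose) (use r in \<open>simp add: homeomorphic_maps_def\<close>)
  moreover have "(r \<circ> G) (sc_embed X x) = f x" if "x \<in> topspace X" for x
    using r that by (simp add: G_embed homeomorphic_maps_def fim)
  ultimately show ?thesis by blast
qed


section \<open>Nets\<close>

definition directed_set :: "'i set \<Rightarrow> ('i \<Rightarrow> 'i \<Rightarrow> bool) \<Rightarrow> bool" where
  "directed_set I le \<longleftrightarrow> I \<noteq> {} \<and> reflp_on I le \<and> transp_on I le \<and>
     (\<forall>i\<in>I. \<forall>j\<in>I. \<exists>k\<in>I. le i k \<and> le j k)"

text \<open>The filter of tails, so that \<^const>\<open>tendsto\<close> and \<^const>\<open>uniform_limit\<close> along it are
  convergence of nets.\<close>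

definition net_filter :: "'i set \<Rightarrow> ('i \<Rightarrow> 'i \<Rightarrow> bool) \<Rightarrow> 'i filter" where
  "net_filter I le = (INF i\<in>I. principal {j\<in>I. le i j})"

lemma eventually_net_filter:
  assumes "directed_set I le"
  shows "eventually P (net_filter I le) \<longleftrightarrow> (\<exists>i\<in>I. \<forall>j\<in>I. le i j \<longrightarrow> P j)"
proof -
  have ne: "I \<noteq> {}" and tr: "transp_on I le"
    and up: "\<forall>i\<in>I. \<forall>j\<in>I. \<exists>k\<in>I. le i k \<and> le j k"
    using assms unfolding directed_set_def by blast+
  have base: "\<exists>k\<in>I. principal {l\<in>I. le k l}
      \<le> inf (principal {l\<in>I. le i l}) (principal {l\<in>I. le j l})"
    if ij: "i \<in> I" "j \<in> I" for i j
  proof -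
    obtain k where k: "k \<in> I" "le i k" "le j k"
      using bspec[OF bspec[OF up ij(1)] ij(2)] by blast
    have "le i l \<and> le j l" if l: "l \<in> I" "le k l" for l
      using transp_onD[OF tr ij(1) k(1) l(1) k(2) l(2)]
        transp_onD[OF tr ij(2) k(1) l(1) k(3) l(2)] by (rule conjI)
    then have "{l\<in>I. le k l} \<subseteq> {l\<in>I. le i l} \<inter> {l\<in>I. le j l}"
      by blast
    then have "principal {l\<in>I. le k l}
        \<le> inf (principal {l\<in>I. le i l}) (principal {l\<in>I. le j l})"
      by (simp only: inf_principal principal_le_iff)
    with k(1) show ?thesis
      by (rule rev_bexI)
  qed
  have "eventually P (net_filter I le)
      \<longleftrightarrow> (\<exists>i\<in>I. eventually P (principal {j\<in>I. le i j}))"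
    unfolding net_filter_def by (rule eventually_INF_base[OF ne base])
  also have "\<dots> \<longleftrightarrow> (\<exists>i\<in>I. \<forall>j\<in>I. le i j \<longrightarrow> P j)"
    by (simp add: eventually_principal Ball_def imp_conjL)
  finally show ?thesis .
qed

lemma tendsto_net_filter:
  fixes h :: "'i \<Rightarrow> real"
  assumes "directed_set I le"
  shows "(h \<longlongrightarrow> 0) (net_filter I le) \<longleftrightarrow> (\<forall>e>0. \<exists>i\<in>I. \<forall>j\<in>I. le i j \<longrightarrow> \<bar>h j\<bar> < e)"
  by (simp only: tendsto_iff eventually_net_filter[OF assms] dist_real_def diff_0_right)

lemma not_tendsto_cofinal:
  fixes h :: "'i \<Rightarrow> real"
  assumes "directed_set I le" "\<not> (h \<longlongrightarrow> 0) (net_filter I le)"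
  shows "\<exists>e>0. \<forall>i\<in>I. \<exists>j\<in>I. le i j \<and> e \<le> \<bar>h j\<bar>"
proof -
  obtain e where e: "e > 0" "\<not> (\<exists>i\<in>I. \<forall>j\<in>I. le i j \<longrightarrow> \<bar>h j\<bar> < e)"
    using assms(2) unfolding tendsto_net_filter[OF assms(1)] by blast
  have "\<exists>j\<in>I. le i j \<and> e \<le> \<bar>h j\<bar>" if "i \<in> I" for i
  proof -
    have "\<not> (\<forall>j\<in>I. le i j \<longrightarrow> \<bar>h j\<bar> < e)"
      using e(2) that by blast
    then show ?thesis
      unfolding not_less[symmetric] by blast
  qed
  with e(1) show ?thesis by blast
qed


section \<open>Tau-smooth, Radon and compactly supported functionals\<close>

definition decreasing_null_net ::
    "'a topology \<Rightarrow> 'i set \<Rightarrow> ('i \<Rightarrow> 'i \<Rightarrow> bool) \<Rightarrow> ('i \<Rightarrow> 'a sc_point \<Rightarrow> real) \<Rightarrow> bool" where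
  "decreasing_null_net X I le \<phi> \<longleftrightarrow>
     directed_set I le \<and> \<phi> ` I \<subseteq> C_space (stone_cech X) \<and>
     (\<forall>x\<in>topspace X.
        (\<forall>i\<in>I. \<forall>j\<in>I. le i j \<longrightarrow> \<phi> i (sc_embed X x) \<ge> \<phi> j (sc_embed X x)) \<and>
        ((\<lambda>i. \<phi> i (sc_embed X x)) \<longlongrightarrow> 0) (net_filter I le))"

definition bounded_compact_null_net ::
    "'a topology \<Rightarrow> 'i set \<Rightarrow> ('i \<Rightarrow> 'i \<Rightarrow> bool) \<Rightarrow> ('i \<Rightarrow> 'a sc_point \<Rightarrow> real) \<Rightarrow> bool" where
  "bounded_compact_null_net X I le \<phi> \<longleftrightarrow>
     directed_set I le \<and> \<phi> ` I \<subseteq> C_space (stone_cech X) \<and>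
     (\<exists>B. \<forall>i\<in>I. \<forall>p\<in>topspace (stone_cech X). \<bar>\<phi> i p\<bar> \<le> B) \<and>
     (\<forall>C. compactin X C \<longrightarrow>
        uniform_limit C (\<lambda>i x. \<phi> i (sc_embed X x)) (\<lambda>_. 0) (net_filter I le))"

text \<open>A definition cannot quantify over the types of all index sets. The index types fixed in the
  next two definitions are large enough: the lemmas \<open>tau_smooth_any_net\<close> and
  \<open>radon_any_net\<close> transfer the conditions to nets with arbitrary index type.\<close>

definition tau_smooth :: "'a topology \<Rightarrow> (('a sc_point \<Rightarrow> real) \<Rightarrow> real) \<Rightarrow> bool" where
  "tau_smooth X \<mu> \<longleftrightarrow>
     (\<forall>(I :: ('a sc_point \<Rightarrow> real) set) le \<phi>.
        decreasing_null_net X I le \<phi> \<longrightarrow> ((\<lambda>i. \<mu> (\<phi> i)) \<longlongrightarrow> 0) (net_filter I le))"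

definition radon :: "'a topology \<Rightarrow> (('a sc_point \<Rightarrow> real) \<Rightarrow> real) \<Rightarrow> bool" where
  "radon X \<mu> \<longleftrightarrow>
     (\<forall>(I :: ('a set \<times> nat) set) le \<phi>.
        bounded_compact_null_net X I le \<phi> \<longrightarrow> ((\<lambda>i. \<mu> (\<phi> i)) \<longlongrightarrow> 0) (net_filter I le))"

lemma tau_smooth_any_net:
  fixes I :: "'i set"
  assumes \<mu>: "tau_smooth X \<mu>" and net: "decreasing_null_net X I le \<phi>"
  shows "((\<lambda>i. \<mu> (\<phi> i)) \<longlongrightarrow> 0) (net_filter I le)"
proof (rule ccontr)
  assume neg: "\<not> ?thesis"
  have dir: "directed_set I le" and C: "\<phi> ` I \<subseteq> C_space (stone_cech X)"
    and dec: "\<And>x i j. \<lbrakk>x \<in> topspace X; i \<in> I; j \<in> I; le i j\<rbrakk>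
      \<Longrightarrow> \<phi> j (sc_embed X x) \<le> \<phi> i (sc_embed X x)"
    and lim: "\<And>x. x \<in> topspace X \<Longrightarrow> ((\<lambda>i. \<phi> i (sc_embed X x)) \<longlongrightarrow> 0) (net_filter I le)"
    using net unfolding decreasing_null_net_def by auto
  obtain \<epsilon> where \<epsilon>: "\<epsilon> > 0" "\<And>i. i \<in> I \<Longrightarrow> \<exists>j\<in>I. le i j \<and> \<epsilon> \<le> \<bar>\<mu> (\<phi> j)\<bar>"
    using not_tendsto_cofinal[OF dir neg] by blast
  have tr: "le i k" if "le i j" "le j k" "i \<in> I" "j \<in> I" "k \<in> I" for i j k
    using dir that unfolding directed_set_def by (meson transp_onD)
  have small: "\<exists>i\<in>I. \<forall>j\<in>I. le i j \<longrightarrow> \<bar>\<phi> j (sc_embed X x)\<bar> < e"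
    if "x \<in> topspace X" "e > 0" for x e
    using lim[OF that(1)] that(2) unfolding tendsto_net_filter[OF dir] by blast
  have nonneg: "0 \<le> \<phi> i (sc_embed X x)" if x: "x \<in> topspace X" and i: "i \<in> I" for x i
  proof (rule ccontr)
    assume "\<not> ?thesis"
    then obtain i0 where i0: "i0 \<in> I"
      "\<And>j. j \<in> I \<Longrightarrow> le i0 j \<Longrightarrow> \<bar>\<phi> j (sc_embed X x)\<bar> < - \<phi> i (sc_embed X x)"
      using small[OF x, of "- \<phi> i (sc_embed X x)"] by auto
    obtain k where "k \<in> I" "le i0 k" "le i k"
      using dir i0(1) i unfolding directed_set_def by blast
    then show False
      using i0(2)[of k] dec[OF x i, of k] by auto
  qed
  define J where "J = {j\<in>I. \<epsilon> \<le> \<bar>\<mu> (\<phi> j)\<bar>}"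
  define S where "S = \<phi> ` J"
  define R where "R g h \<longleftrightarrow> (\<forall>x\<in>topspace X. h (sc_embed X x) \<le> g (sc_embed X x))"
    for g h :: "'a sc_point \<Rightarrow> real"
  have cof: "\<exists>j\<in>J. le i j" if "i \<in> I" for i
    using \<epsilon>(2)[OF that] by (auto simp: J_def)
  have dirS: "directed_set S R"
    unfolding directed_set_def
  proof (intro conjI ballI)
    show "S \<noteq> {}"
      using dir cof by (auto simp: S_def directed_set_def)
    show "reflp_on S R"
      by (auto simp: reflp_on_def R_def)
    show "transp_on S R"
      by (rule transp_onI) (unfold R_def, force)
    fix g h assume "g \<in> S" "h \<in> S"
    then obtain i j where ij: "i \<in> J" "g = \<phi> i" "j \<in> J" "h = \<phi> j"
      by (auto simp: S_def)
    then obtain k where k: "k \<in> I" "le i k" "le j k"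
      using dir unfolding directed_set_def J_def by blast
    then obtain l where l: "l \<in> J" "le k l"
      using cof by blast
    have "i \<in> I" "j \<in> I" "l \<in> I"
      using ij l by (auto simp: J_def)
    then have "R g (\<phi> l)" "R h (\<phi> l)"
      using tr[of i k l] tr[of j k l] k l ij dec by (auto simp: R_def)
    with l show "\<exists>f\<in>S. R g f \<and> R h f"
      by (auto simp: S_def)
  qed
  have "decreasing_null_net X S R (\<lambda>g. g)"
    unfolding decreasing_null_net_def
  proof (intro conjI ballI impI)
    show "directed_set S R" by (fact dirS)
    show "(\<lambda>g. g) ` S \<subseteq> C_space (stone_cech X)"
      using C by (auto simp: S_def J_def)
    fix x assume x: "x \<in> topspace X"
    show "h (sc_embed X x) \<le> g (sc_embed X x)" if "R g h" for g h
      using that x by (simp add: R_def)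
    show "((\<lambda>g. g (sc_embed X x)) \<longlongrightarrow> 0) (net_filter S R)"
      unfolding tendsto_net_filter[OF dirS]
    proof (intro allI impI)
      fix e :: real assume "e > 0"
      then obtain i where i: "i \<in> I" "\<And>j. j \<in> I \<Longrightarrow> le i j \<Longrightarrow> \<bar>\<phi> j (sc_embed X x)\<bar> < e"
        using small[OF x] by blast
      obtain j where j: "j \<in> J" "le i j"
        using cof i by blast
      have "\<bar>g (sc_embed X x)\<bar> < e" if g: "g \<in> S" "R (\<phi> j) g" for g
      proof -
        have "0 \<le> g (sc_embed X x)"
          using g(1) nonneg x by (auto simp: S_def J_def)
        moreover have "g (sc_embed X x) \<le> \<phi> j (sc_embed X x)"
          using g(2) x by (simp add: R_def)
        moreover have "\<bar>\<phi> j (sc_embed X x)\<bar> < e"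
          using i j by (simp add: J_def)
        ultimately show ?thesis by linarith
      qed
      with j show "\<exists>f\<in>S. \<forall>g\<in>S. R f g \<longrightarrow> \<bar>g (sc_embed X x)\<bar> < e"
        by (auto simp: S_def)
    qed
  qed
  then have "((\<lambda>g. \<mu> g) \<longlongrightarrow> 0) (net_filter S R)"
    using \<mu> unfolding tau_smooth_def by blast
  then obtain g where "g \<in> S" "\<forall>h\<in>S. R g h \<longrightarrow> \<bar>\<mu> h\<bar> < \<epsilon>"
    using \<epsilon>(1) unfolding tendsto_net_filter[OF dirS] by blast
  then have "\<bar>\<mu> g\<bar> < \<epsilon>"
    by (simp add: R_def)
  with \<open>g \<in> S\<close> show False
    by (auto simp: S_def J_def)
qed

lemma radon_any_net:
  fixes I :: "'i set"
  assumes \<mu>: "radon X \<mu>" and net: "bounded_compact_null_net X I le \<phi>"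
  shows "((\<lambda>i. \<mu> (\<phi> i)) \<longlongrightarrow> 0) (net_filter I le)"
proof (rule ccontr)
  assume neg: "\<not> ?thesis"
  have dir: "directed_set I le" and C: "\<phi> ` I \<subseteq> C_space (stone_cech X)"
    and lim: "\<And>C. compactin X C \<Longrightarrow>
      uniform_limit C (\<lambda>i x. \<phi> i (sc_embed X x)) (\<lambda>_. 0) (net_filter I le)"
    using net unfolding bounded_compact_null_net_def by auto
  obtain B where B: "\<And>i p. i \<in> I \<Longrightarrow> p \<in> topspace (stone_cech X) \<Longrightarrow> \<bar>\<phi> i p\<bar> \<le> B"
    using net unfolding bounded_compact_null_net_def by blast
  obtain \<epsilon> where \<epsilon>: "\<epsilon> > 0" "\<And>i. i \<in> I \<Longrightarrow> \<exists>j\<in>I. le i j \<and> \<epsilon> \<le> \<bar>\<mu> (\<phi> j)\<bar>"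
    using not_tendsto_cofinal[OF dir neg] by blast
  define S where "S = {C. compactin X C} \<times> (UNIV :: nat set)"
  define R where "R a b \<longleftrightarrow> fst a \<subseteq> fst b \<and> snd a \<le> snd b" for a b :: "'a set \<times> nat"
  have "\<exists>j\<in>I. \<epsilon> \<le> \<bar>\<mu> (\<phi> j)\<bar> \<and> (\<forall>x\<in>fst a. \<bar>\<phi> j (sc_embed X x)\<bar> < inverse (real (Suc (snd a))))"
    if "a \<in> S" for a
  proof -
    have "compactin X (fst a)"
      using that by (auto simp: S_def)
    from uniform_limitD[OF lim[OF this], of "inverse (real (Suc (snd a)))"]
    obtain i where "i \<in> I"
      "\<forall>j\<in>I. le i j \<longrightarrow> (\<forall>x\<in>fst a. \<bar>\<phi> j (sc_embed X x)\<bar> < inverse (real (Suc (snd a))))"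
      unfolding eventually_net_filter[OF dir] dist_real_def diff_0_right
      by auto
    with \<epsilon>(2) show ?thesis
      by blast
  qed
  then obtain j where j: "\<And>a. a \<in> S \<Longrightarrow> j a \<in> I" "\<And>a. a \<in> S \<Longrightarrow> \<epsilon> \<le> \<bar>\<mu> (\<phi> (j a))\<bar>"
    "\<And>a x. a \<in> S \<Longrightarrow> x \<in> fst a \<Longrightarrow> \<bar>\<phi> (j a) (sc_embed X x)\<bar> < inverse (real (Suc (snd a)))"
    by metis
  have dirS: "directed_set S R"
    unfolding directed_set_def
  proof (intro conjI ballI)
    show "S \<noteq> {}"
      by (auto simp: S_def)
    show "reflp_on S R"
      by (auto simp: reflp_on_def R_def)
    show "transp_on S R"
      by (rule transp_onI) (auto simp: R_def)
    fix a b assume "a \<in> S" "b \<in> S"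
    then have "(fst a \<union> fst b, max (snd a) (snd b)) \<in> S"
      by (auto simp: S_def intro: compactin_Un)
    moreover have "R a (fst a \<union> fst b, max (snd a) (snd b))"
      "R b (fst a \<union> fst b, max (snd a) (snd b))"
      by (auto simp: R_def)
    ultimately show "\<exists>c\<in>S. R a c \<and> R b c"
      by blast
  qed
  have "bounded_compact_null_net X S R (\<lambda>a. \<phi> (j a))"
    unfolding bounded_compact_null_net_def
  proof (intro conjI allI impI)
    show "directed_set S R" by (fact dirS)
    show "(\<lambda>a. \<phi> (j a)) ` S \<subseteq> C_space (stone_cech X)"
      using C j(1) by auto
    show "\<exists>B. \<forall>a\<in>S. \<forall>p\<in>topspace (stone_cech X). \<bar>\<phi> (j a) p\<bar> \<le> B"
      using B j(1) by blast
    fix D assume D: "compactin X D"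
    show "uniform_limit D (\<lambda>a x. \<phi> (j a) (sc_embed X x)) (\<lambda>_. 0) (net_filter S R)"
      unfolding uniform_limit_iff eventually_net_filter[OF dirS]
    proof (intro allI impI)
      fix e :: real assume "e > 0"
      then obtain n where n: "inverse (real (Suc n)) < e"
        using reals_Archimedean by blast
      have "\<bar>\<phi> (j a) (sc_embed X x)\<bar> < e" if a: "a \<in> S" "R (D, n) a" and x: "x \<in> D" for a x
      proof -
        have "\<bar>\<phi> (j a) (sc_embed X x)\<bar> < inverse (real (Suc (snd a)))"
          using a x by (intro j(3)) (auto simp: R_def)
        also have "\<dots> \<le> inverse (real (Suc n))"
          using a(2) by (intro le_imp_inverse_le) (auto simp: R_def)
        finally show ?thesis
          using n by linarith
      qed
      moreover have "(D, n) \<in> S"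
        using D by (simp add: S_def)
      ultimately show "\<exists>a\<in>S. \<forall>b\<in>S. R a b \<longrightarrow> (\<forall>x\<in>D. dist (\<phi> (j b) (sc_embed X x)) 0 < e)"
        unfolding dist_real_def diff_0_right by blast
    qed
  qed
  then have "((\<lambda>a. \<mu> (\<phi> (j a))) \<longlongrightarrow> 0) (net_filter S R)"
    using \<mu> unfolding radon_def by blast
  then obtain a where "a \<in> S" "\<forall>b\<in>S. R a b \<longrightarrow> \<bar>\<mu> (\<phi> (j b))\<bar> < \<epsilon>"
    using \<epsilon>(1) unfolding tendsto_net_filter[OF dirS] by blast
  then have "\<bar>\<mu> (\<phi> (j a))\<bar> < \<epsilon>"
    by (simp add: R_def)
  with j(2)[OF \<open>a \<in> S\<close>] show False
    by simp
qed

definition O_tau :: "'a topology \<Rightarrow> (('a sc_point \<Rightarrow> real) \<Rightarrow> real) set" where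
  "O_tau X = {\<mu> \<in> O_set (stone_cech X). tau_smooth X \<mu>}"

definition O_radon :: "'a topology \<Rightarrow> (('a sc_point \<Rightarrow> real) \<Rightarrow> real) set" where
  "O_radon X = {\<mu> \<in> O_set (stone_cech X). radon X \<mu>}"

definition O_beta :: "'a topology \<Rightarrow> (('a sc_point \<Rightarrow> real) \<Rightarrow> real) set" where
  "O_beta X = {\<mu> \<in> O_set (stone_cech X). supp (stone_cech X) \<mu> \<subseteq> sc_embed X ` topspace X}"

end

theory Submission
  imports Defs "HOL-Algebra.Free_Abelian_Groups"
begin

text \<open>
  A single family of functionals serves all four spaces. For a finite nonempty family \<open>L\<close> of
  finite nonempty sets of pairs (point, rational offset), the functional
  \<open>f \<mapsto> max\<^bsub>S \<in> L\<^esub> min\<^bsub>(x,q) \<in> S\<^esub> (f x + q)\<close>, normalized to vanish at \<open>0\<close>, is order-preserving,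
  weakly additive and normed. It depends only on the values of \<open>f\<close> on a finite set of points, and
  it is nonexpansive for the sup norm over that set; hence if the points lie in \<open>X\<close> it is
  \<open>\<tau>\<close>-smooth, Radon and supported on a finite subset of \<open>X\<close>
  (\<open>max_min_functional_tendsto_0\<close>, \<open>supp_max_min_functional\<close>).

  These functionals are dense, even when the points are restricted to a dense set \<open>P\<close>
  (\<open>max_min_functional_approximates\<close>). Given \<open>\<mu>\<close> and a finite set \<open>G\<close> of functions, consider
  \<open>f \<mapsto> max\<^bsub>g \<in> G\<^esub> min\<^bsub>x\<^esub> (f x - g x + \<mu> g)\<close>. At \<open>f \<in> G\<close> the term \<open>g = f\<close> contributes \<open>\<mu> f\<close>. No
  other term exceeds \<open>\<mu> f\<close> noticeably, since an order-preserving weakly additive \<open>\<mu>\<close> satisfies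
  \<open>\<mu> g + inf (f - g) \<le> \<mu> f\<close> and the infimum is nearly attained at a point of \<open>P\<close>; one point
  for each pair in \<open>G \<times> G\<close> is enough. The offsets \<open>\<mu> g - g x\<close> can be rounded to rationals.

  If \<open>P\<close> is the image of a dense subset of \<open>X\<close> of least cardinality, then \<open>P\<close> is infinite, because
  a finite dense subset of a Hausdorff space is the whole space. Hence there are at most \<open>|P|\<close>
  such families \<open>L\<close>.
\<close>

section \<open>Max-min functionals with finitely many nodes\<close>

text \<open>Rational offsets keep the set no larger than \<open>P\<close> when \<open>P\<close> is infinite. Nonemptiness at both
  levels keeps \<^const>\<open>Max\<close> and \<^const>\<open>Min\<close> below from being taken over empty sets.\<close>

definition max_min_data :: "'b set \<Rightarrow> ('b \<times> real) set set set" where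
  "max_min_data P = {L. finite L \<and> L \<noteq> {} \<and> (\<forall>S\<in>L. finite S \<and> S \<noteq> {} \<and> S \<subseteq> P \<times> \<rat>)}"

definition max_min :: "('b \<times> real) set set \<Rightarrow> ('b \<Rightarrow> real) \<Rightarrow> real" where
  "max_min L f = Max ((\<lambda>S. Min ((\<lambda>(x, q). f x + q) ` S)) ` L)"

definition max_min_functional ::
    "'b topology \<Rightarrow> ('b \<times> real) set set \<Rightarrow> ('b \<Rightarrow> real) \<Rightarrow> real" where
  "max_min_functional K L = (\<lambda>f\<in>C_space K. max_min L f - max_min L (\<lambda>_. 0))"

lemma max_min_le_iff:
  assumes "L \<in> max_min_data P"
  shows "max_min L f \<le> c \<longleftrightarrow> (\<forall>S\<in>L. \<exists>(x, q)\<in>S. f x + q \<le> c)"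
  using assms by (auto simp: max_min_data_def max_min_def Min_le_iff case_prod_beta)

lemma max_min_ge_iff:
  assumes "L \<in> max_min_data P"
  shows "c \<le> max_min L f \<longleftrightarrow> (\<exists>S\<in>L. \<forall>(x, q)\<in>S. c \<le> f x + q)"
  using assms by (auto simp: max_min_data_def max_min_def Max_ge_iff case_prod_beta)

text \<open>Monotonicity, commutation with constants and nonexpansiveness are all instances of this
  inequality.\<close>

lemma max_min_le_add:
  assumes L: "L \<in> max_min_data P" and le: "\<And>x. x \<in> P \<Longrightarrow> f x \<le> g x + c"
  shows "max_min L f \<le> max_min L g + c"
  unfolding max_min_le_iff[OF L]
proof
  fix S assume S: "S \<in> L"
  have "\<forall>S\<in>L. \<exists>(x, q)\<in>S. g x + q \<le> max_min L g"
    using max_min_le_iff[OF L, of g "max_min L g"] by blast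
  then obtain x q where xq: "(x, q) \<in> S" "g x + q \<le> max_min L g"
    using S by blast
  have "x \<in> P"
    using L S xq(1) by (auto simp: max_min_data_def)
  from le[OF this] xq have "f x + q \<le> max_min L g + c"
    by linarith
  with xq(1) show "\<exists>(x, q)\<in>S. f x + q \<le> max_min L g + c"
    by blast
qed

lemma max_min_eq_add:
  assumes "L \<in> max_min_data P" and "\<And>x. x \<in> P \<Longrightarrow> f x = g x + c"
  shows "max_min L f = max_min L g + c"
  using max_min_le_add[OF assms(1), of f g c] max_min_le_add[OF assms(1), of g f "- c"] assms(2)
  by force

text \<open>The lemmas about \<^const>\<open>max_min_data\<close> hold for every set containing the nodes of \<open>L\<close>, so
  passing to the least one turns them into statements about finitely many values of \<open>f\<close>.\<close>

lemma max_min_data_finite_nodes: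
  assumes "L \<in> max_min_data P"
  shows "\<exists>F. finite F \<and> F \<subseteq> P \<and> L \<in> max_min_data F"
proof (intro exI conjI)
  let ?F = "\<Union>S\<in>L. fst ` S"
  have sub: "S \<subseteq> P \<times> \<rat>" if "S \<in> L" for S
    using assms that by (simp add: max_min_data_def)
  show "finite ?F"
    using assms by (auto simp: max_min_data_def)
  show "?F \<subseteq> P"
    using sub by fastforce
  have "S \<subseteq> ?F \<times> \<rat>" if "S \<in> L" for S
    using sub[OF that] that by force
  then show "L \<in> max_min_data ?F"
    using assms by (simp add: max_min_data_def)
qed

lemma add_fun_const_in_C_space:
  assumes "f \<in> C_space K"
  shows "add_fun K f (const_fun K c) \<in> C_space K"
proof -
  have "continuous_map K euclideanreal (\<lambda>x. f x + c)"
    using assms by (intro continuous_map_add) (auto simp: C_space_def)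
  then have "continuous_map K euclideanreal (add_fun K f (const_fun K c))"
    by (rule continuous_map_eq) (simp add: add_fun_def const_fun_def)
  then show ?thesis
    by (simp add: C_space_def add_fun_def)
qed

lemma const_fun_in_C_space: "const_fun K c \<in> C_space K"
  by (auto simp: C_space_def const_fun_def intro!: continuous_map_eq[where f = "\<lambda>x. c"])

lemma max_min_functional_in_O_set:
  assumes L: "L \<in> max_min_data P" and P: "P \<subseteq> topspace K"
  shows "max_min_functional K L \<in> O_set K"
proof -
  have one: "max_min_functional K L (const_fun K 1) = 1"
  proof -
    have "max_min L (const_fun K 1) = max_min L (\<lambda>_. 0) + 1"
      using P by (intro max_min_eq_add[OF L]) (auto simp: const_fun_def)
    then show ?thesis
      by (simp add: max_min_functional_def const_fun_in_C_space)
  qed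
  have "max_min L f \<le> max_min L g" if "\<forall>x\<in>topspace K. f x \<le> g x" for f g
    using max_min_le_add[OF L, of f g 0] that P by auto
  then have "order_preserving K (max_min_functional K L)"
    by (simp add: order_preserving_def max_min_functional_def)
  moreover have "max_min L (add_fun K f (const_fun K c)) = max_min L f + c" for f c
    using P by (intro max_min_eq_add[OF L]) (auto simp: add_fun_def const_fun_def)
  then have "weakly_additive K (max_min_functional K L)"
    by (simp add: weakly_additive_def one) (simp add: max_min_functional_def add_fun_const_in_C_space)
  ultimately show ?thesis
    using one by (simp add: O_set_def normed_def) (simp add: max_min_functional_def)
qed

lemma abs_max_min_functional_le:
  assumes L: "L \<in> max_min_data F" and f: "f \<in> C_space K" and e: "\<And>x. x \<in> F \<Longrightarrow> \<bar>f x\<bar> \<le> e"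
  shows "\<bar>max_min_functional K L f\<bar> \<le> e"
proof -
  have "f x \<le> 0 + e" "0 \<le> f x + e" if "x \<in> F" for x
    using e[OF that] by auto
  then have "max_min L f \<le> max_min L (\<lambda>_. 0) + e" "max_min L (\<lambda>_. 0) \<le> max_min L f + e"
    using max_min_le_add[OF L, of f "\<lambda>_. 0" e] max_min_le_add[OF L, of "\<lambda>_. 0" f e] by auto
  then show ?thesis
    using f by (simp add: max_min_functional_def)
qed

text \<open>Both kinds of nets, those defining \<open>\<tau>\<close>-smooth and those defining Radon functionals,
  converge to zero at each of the finitely many nodes.\<close>

lemma max_min_functional_tendsto_0:
  fixes le :: "'i \<Rightarrow> 'i \<Rightarrow> bool"
  assumes L: "L \<in> max_min_data F" and F: "finite F"
    and dir: "directed_set I le" and \<phi>: "\<phi> ` I \<subseteq> C_space K"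
    and lim: "\<And>x. x \<in> F \<Longrightarrow> ((\<lambda>i. \<phi> i x) \<longlongrightarrow> 0) (net_filter I le)"
  shows "((\<lambda>i. max_min_functional K L (\<phi> i)) \<longlongrightarrow> 0) (net_filter I le)"
proof (rule Lim_null_comparison)
  show "((\<lambda>i. \<Sum>x\<in>F. \<bar>\<phi> i x\<bar>) \<longlongrightarrow> 0) (net_filter I le)"
    using lim by (intro tendsto_null_sum tendsto_rabs_zero) auto
  have "\<bar>max_min_functional K L (\<phi> i)\<bar> \<le> (\<Sum>x\<in>F. \<bar>\<phi> i x\<bar>)" if "i \<in> I" for i
  proof (rule abs_max_min_functional_le[OF L])
    show "\<phi> i \<in> C_space K"
      using \<phi> that by blast
    show "\<bar>\<phi> i x\<bar> \<le> (\<Sum>x\<in>F. \<bar>\<phi> i x\<bar>)" if "x \<in> F" for x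
      using that F by (intro member_le_sum[where f = "\<lambda>x. \<bar>\<phi> i x\<bar>"]) auto
  qed
  moreover have "I \<noteq> {}"
    using dir by (simp add: directed_set_def)
  ultimately show "\<forall>\<^sub>F i in net_filter I le.
      norm (max_min_functional K L (\<phi> i)) \<le> (\<Sum>x\<in>F. \<bar>\<phi> i x\<bar>)"
    by (auto simp: eventually_net_filter[OF dir])
qed

text \<open>The functional factors through restriction to the nodes, where the same formula defines an
  element of \<open>O(F)\<close>; the finite set \<open>F\<close> is closed because \<open>K\<close> is Hausdorff.\<close>

lemma supp_max_min_functional:
  assumes K: "Hausdorff_space K" and L: "L \<in> max_min_data F"
    and F: "finite F" "F \<subseteq> topspace K"
  shows "supp K (max_min_functional K L) \<subseteq> F"
proof -
  have top: "topspace (subtopology K F) = F"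
    using F by auto
  have "max_min_functional K L f = max_min_functional (subtopology K F) L (restrict f F)"
    if f: "f \<in> C_space K" for f
  proof -
    have "continuous_map (subtopology K F) euclideanreal f"
      using f by (simp add: C_space_def continuous_map_from_subtopology)
    then have "continuous_map (subtopology K F) euclideanreal (restrict f F)"
      by (rule continuous_map_eq) (simp add: top)
    then have "restrict f F \<in> C_space (subtopology K F)"
      unfolding C_space_def top by simp
    moreover have "max_min L (restrict f F) = max_min L f"
      using max_min_eq_add[OF L, of "restrict f F" f 0] by simp
    ultimately show ?thesis
      using f by (simp add: max_min_functional_def)
  qed
  then have "max_min_functional K L = O_embed K F (max_min_functional (subtopology K F) L)"
    unfolding O_embed_def by (auto simp: fun_eq_iff restrict_def) (simp add: max_min_functional_def)
  moreover have "max_min_functional (subtopology K F) L \<in> O_set (subtopology K F)"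
    using top by (intro max_min_functional_in_O_set[OF L]) simp
  ultimately have "supported_on K (max_min_functional K L) F"
    unfolding supported_on_def by blast
  moreover have "closedin K F"
    using K F by (simp add: closedin_Hausdorff_finite)
  ultimately show ?thesis
    unfolding supp_def by blast
qed

lemma max_min_functional_tau_radon_beta:
  assumes L: "L \<in> max_min_data (sc_embed X ` topspace X)"
  shows "max_min_functional (stone_cech X) L \<in> O_tau X \<inter> O_radon X \<inter> O_beta X"
proof -
  let ?K = "stone_cech X"
  have emb: "sc_embed X ` topspace X \<subseteq> topspace ?K"
    using sc_embed_dense[of X] by (simp add: dense_in_def)
  obtain F where F: "finite F" "F \<subseteq> sc_embed X ` topspace X" and LF: "L \<in> max_min_data F"
    using max_min_data_finite_nodes[OF L] by blast
  have "tau_smooth X (max_min_functional ?K L)"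
    unfolding tau_smooth_def decreasing_null_net_def
    using F(2) by (auto intro!: max_min_functional_tendsto_0[OF LF F(1)])
  moreover have "radon X (max_min_functional ?K L)"
    unfolding radon_def bounded_compact_null_net_def
  proof (intro allI impI, elim conjE)
    fix I :: "('a set \<times> nat) set" and le \<phi>
    assume dir: "directed_set I le" and \<phi>: "\<phi> ` I \<subseteq> C_space ?K"
      and lim: "\<forall>C. compactin X C \<longrightarrow>
        uniform_limit C (\<lambda>i x. \<phi> i (sc_embed X x)) (\<lambda>_. 0) (net_filter I le)"
    have "((\<lambda>i. \<phi> i (sc_embed X x)) \<longlongrightarrow> 0) (net_filter I le)" if "x \<in> topspace X" for x
    proof -
      have "compactin X {x}"
        using that by (simp add: finite_imp_compactin)
      with lim have "uniform_limit {x} (\<lambda>i x. \<phi> i (sc_embed X x)) (\<lambda>_. 0) (net_filter I le)"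
        by blast
      then show ?thesis
        by (rule tendsto_uniform_limitI) simp
    qed
    then show "((\<lambda>i. max_min_functional ?K L (\<phi> i)) \<longlongrightarrow> 0) (net_filter I le)"
      using F(2) by (intro max_min_functional_tendsto_0[OF LF F(1) dir \<phi>]) auto
  qed
  moreover have "supp ?K (max_min_functional ?K L) \<subseteq> sc_embed X ` topspace X"
    using supp_max_min_functional[OF stone_cech_Hausdorff LF F(1)] F(2) emb by blast
  ultimately show ?thesis
    using max_min_functional_in_O_set[OF L emb]
    by (simp add: O_tau_def O_radon_def O_beta_def)
qed


section \<open>Approximation in the topology of pointwise convergence\<close>

text \<open>This is \<open>\<mu> g + inf (f - g) \<le> \<mu> f\<close>, with the infimum approached within the dense set:
  were \<open>f - g\<close> above \<open>c = \<mu> f - \<mu> g + e\<close> on \<open>P\<close>, then \<open>g + c \<le> f\<close> everywhere by continuity, so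
  \<open>\<mu> g + c \<le> \<mu> f\<close>.\<close>

lemma dense_point_with_small_difference:
  assumes \<mu>: "\<mu> \<in> O_set K" and P: "dense_in K P"
    and f: "f \<in> C_space K" and g: "g \<in> C_space K" and e: "e > 0"
  shows "\<exists>x\<in>P. f x - g x \<le> \<mu> f - \<mu> g + e"
proof (rule ccontr)
  define c where "c = \<mu> f - \<mu> g + e"
  assume "\<not> ?thesis"
  then have above: "c \<le> f x - g x" if "x \<in> P" for x
    using that unfolding c_def by force
  have "continuous_map K euclideanreal (\<lambda>x. f x - g x)"
    using f g by (intro continuous_map_diff) (simp_all add: C_space_def)
  then have "closedin K {x \<in> topspace K. f x - g x \<in> {c..}}"
    by (rule closedin_continuous_map_preimage) simp
  moreover have "P \<subseteq> {x \<in> topspace K. f x - g x \<in> {c..}}"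
    using above P by (auto simp: dense_in_def)
  ultimately have "K closure_of P \<subseteq> {x \<in> topspace K. f x - g x \<in> {c..}}"
    by (intro closure_of_minimal)
  then have "\<forall>x\<in>topspace K. add_fun K g (const_fun K c) x \<le> f x"
    using P by (force simp: dense_in_def add_fun_def const_fun_def)
  then have "\<mu> (add_fun K g (const_fun K c)) \<le> \<mu> f"
    using \<mu> f add_fun_const_in_C_space[OF g] by (auto simp: O_set_def order_preserving_def)
  moreover have "\<mu> (add_fun K g (const_fun K c)) = \<mu> g + c"
    using \<mu> g by (simp add: O_set_def weakly_additive_def normed_def)
  ultimately show False
    using e by (simp add: c_def)
qed

text \<open>The family has one set \<open>S g\<close> for each \<open>g \<in> G\<close>. Its offsets \<open>\<mu> g - g x\<close>, up to rounding, make
  \<open>f x + q\<close> close to \<open>\<mu> f\<close> at all nodes when \<open>g = f\<close>, which gives the lower bound. The node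
  \<open>p f g\<close>, chosen by the preceding lemma, makes the minimum over \<open>S g\<close> at most about \<open>\<mu> f\<close>, which
  gives the upper bound.\<close>

lemma max_min_approximates:
  assumes \<mu>: "\<mu> \<in> O_set K" and P: "dense_in K P"
    and G: "finite G" "G \<noteq> {}" "G \<subseteq> C_space K" and e: "e > 0"
  shows "\<exists>L\<in>max_min_data P. \<forall>f\<in>G. \<bar>max_min L f - \<mu> f\<bar> \<le> e"
proof -
  have "\<exists>q\<in>\<rat>. \<bar>q - t\<bar> \<le> e / 2" for t :: real
  proof -
    obtain q where "q \<in> \<rat>" "t < q" "q < t + e / 2"
      using Rats_dense_in_real[of t "t + e / 2"] e by auto
    then show ?thesis by (intro bexI[of _ q]) auto
  qed
  then obtain r where r: "\<And>t :: real. r t \<in> \<rat>" "\<And>t. \<bar>r t - t\<bar> \<le> e / 2"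
    by metis
  have "\<forall>f\<in>G. \<forall>g\<in>G. \<exists>x\<in>P. f x - g x \<le> \<mu> f - \<mu> g + e / 2"
    using dense_point_with_small_difference[OF \<mu> P, of _ _ "e / 2"] G(3) e by auto
  then obtain p where p: "\<And>f g. f \<in> G \<Longrightarrow> g \<in> G \<Longrightarrow>
      p f g \<in> P \<and> f (p f g) - g (p f g) \<le> \<mu> f - \<mu> g + e / 2"
    by metis
  define F where "F = (\<lambda>(f, g). p f g) ` (G \<times> G)"
  define S where "S g = (\<lambda>x. (x, r (\<mu> g - g x))) ` F" for g
  have "finite F" "F \<noteq> {}" "F \<subseteq> P"
    using G p by (auto simp: F_def)
  then have L: "S ` G \<in> max_min_data P"
    using G r(1) by (auto simp: max_min_data_def S_def)
  have "\<bar>max_min (S ` G) f - \<mu> f\<bar> \<le> e" if f: "f \<in> G" for f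
  proof -
    have "\<mu> f - e / 2 \<le> f x + r (\<mu> f - f x)" for x
      using abs_le_D2[OF r(2)[of "\<mu> f - f x"]] by linarith
    then have "\<mu> f - e / 2 \<le> max_min (S ` G) f"
      unfolding max_min_ge_iff[OF L] using f by (auto simp: S_def)
    moreover have "\<exists>(x, q)\<in>S g. f x + q \<le> \<mu> f + e" if g: "g \<in> G" for g
    proof
      show "(p f g, r (\<mu> g - g (p f g))) \<in> S g"
        using f g by (auto simp: S_def F_def)
      have "f (p f g) + r (\<mu> g - g (p f g)) \<le> \<mu> f + e"
        using p[OF f g] abs_le_D1[OF r(2)[of "\<mu> g - g (p f g)"]] by linarith
      then show "case (p f g, r (\<mu> g - g (p f g))) of (x, q) \<Rightarrow> f x + q \<le> \<mu> f + e"
        by simp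
    qed
    then have "max_min (S ` G) f \<le> \<mu> f + e"
      unfolding max_min_le_iff[OF L] by auto
    ultimately show ?thesis
      using e by auto
  qed
  with L show ?thesis by blast
qed

lemma O_set_const_0:
  assumes "\<mu> \<in> O_set K"
  shows "\<mu> (const_fun K 0) = 0"
proof -
  have "add_fun K (const_fun K 0) (const_fun K 1) = const_fun K 1"
    by (auto simp: add_fun_def const_fun_def fun_eq_iff)
  moreover have "\<mu> (add_fun K (const_fun K 0) (const_fun K 1)) = \<mu> (const_fun K 0) + 1"
    using assms by (simp add: O_set_def weakly_additive_def normed_def const_fun_in_C_space)
  ultimately show ?thesis
    using assms by (simp add: O_set_def normed_def)
qed

lemma max_min_functional_approximates:
  assumes \<mu>: "\<mu> \<in> O_set K" and P: "dense_in K P"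
    and G: "finite G" "G \<subseteq> C_space K" and e: "e > 0"
  shows "\<exists>L\<in>max_min_data P. \<forall>f\<in>G. \<bar>max_min_functional K L f - \<mu> f\<bar> < e"
proof -
  \<comment> \<open>Including the zero function controls the normalizing constant.\<close>
  let ?z = "const_fun K 0"
  obtain L where L: "L \<in> max_min_data P"
    and app: "\<forall>f\<in>insert ?z G. \<bar>max_min L f - \<mu> f\<bar> \<le> e / 3"
    using max_min_approximates[OF \<mu> P, of "insert ?z G" "e / 3"] G e const_fun_in_C_space
    by auto
  have "max_min L ?z = max_min L (\<lambda>_. 0)"
    using max_min_eq_add[OF L, of ?z "\<lambda>_. 0" 0] P
    by (simp add: const_fun_def dense_in_def subset_iff)
  then have "\<bar>max_min L (\<lambda>_. 0)\<bar> \<le> e / 3"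
    using app O_set_const_0[OF \<mu>] by auto
  then have "\<bar>max_min L f - max_min L (\<lambda>_. 0) - \<mu> f\<bar> < e" if "f \<in> G" for f
    using bspec[OF app, of f] that e by (simp add: abs_if split: if_splits)
  then have "\<forall>f\<in>G. \<bar>max_min_functional K L f - \<mu> f\<bar> < e"
    using G(2) by (auto simp: max_min_functional_def)
  with L show ?thesis by blast
qed

text \<open>A basic neighbourhood in the product topology restricts only finitely many coordinates. The
  coordinates here are the elements of \<open>C(K)\<close>.\<close>

lemma dense_in_pointwise_topologyI:
  assumes S: "S \<subseteq> O_set K" and N: "N \<subseteq> S"
    and approx: "\<And>\<mu> G e. \<lbrakk>\<mu> \<in> S; finite G; G \<subseteq> C_space K; e > 0\<rbrakk>
      \<Longrightarrow> \<exists>\<nu>\<in>N. \<forall>f\<in>G. \<bar>\<nu> f - \<mu> f\<bar> < (e :: real)"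
  shows "dense_in (pointwise_topology K S) N"
proof -
  have "\<exists>\<nu>\<in>N. \<nu> \<in> T" if \<mu>: "\<mu> \<in> S" "\<mu> \<in> T" and T: "openin (pointwise_topology K S) T" for \<mu> T
  proof -
    obtain W where W: "openin (product_topology (\<lambda>_. euclideanreal) (C_space K)) W" "T = W \<inter> S"
      using T by (auto simp: pointwise_topology_def openin_subtopology)
    then obtain U where U: "finite {f \<in> C_space K. U f \<noteq> UNIV}" "\<And>f. f \<in> C_space K \<Longrightarrow> open (U f)"
      "\<mu> \<in> Pi\<^sub>E (C_space K) U" "Pi\<^sub>E (C_space K) U \<subseteq> W"
      using \<mu>(2) by (auto simp: openin_product_topology_alt)
    define G where "G = {f \<in> C_space K. U f \<noteq> UNIV}"
    have "\<exists>d>0. \<forall>y. \<bar>y - \<mu> f\<bar> < d \<longrightarrow> y \<in> U f" if "f \<in> G" for f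
      using U(2)[of f] U(3) that by (force simp: G_def open_dist dist_real_def PiE_iff)
    then obtain d where d: "\<And>f. f \<in> G \<Longrightarrow> d f > 0"
      "\<And>f y. f \<in> G \<Longrightarrow> \<bar>y - \<mu> f\<bar> < d f \<Longrightarrow> y \<in> U f"
      by metis
    \<comment> \<open>The \<open>1\<close> keeps the minimum defined when no coordinate is restricted.\<close>
    define e where "e = Min (insert 1 (d ` G))"
    have G: "finite G" "G \<subseteq> C_space K"
      using U(1) by (auto simp: G_def)
    have "e > 0" and e: "\<And>f. f \<in> G \<Longrightarrow> e \<le> d f"
      using G(1) d(1) by (auto simp: e_def)
    then obtain \<nu> where \<nu>: "\<nu> \<in> N" "\<forall>f\<in>G. \<bar>\<nu> f - \<mu> f\<bar> < e"
      using approx[OF \<mu>(1) G] by blast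
    have "\<nu> f \<in> U f" if "f \<in> C_space K" for f
    proof (cases "f \<in> G")
      case True
      then have "\<bar>\<nu> f - \<mu> f\<bar> < d f"
        using e[OF True] \<nu>(2) by force
      then show ?thesis by (rule d(2)[OF True])
    next
      case False
      with that show ?thesis by (simp add: G_def)
    qed
    moreover have "\<nu> \<in> extensional (C_space K)"
      using \<nu>(1) N S by (auto simp: O_set_def)
    ultimately have "\<nu> \<in> Pi\<^sub>E (C_space K) U"
      by (simp add: PiE_iff)
    with U(4) have "\<nu> \<in> W" ..
    with \<nu>(1) N W(2) show ?thesis by blast
  qed
  then show ?thesis
    using N unfolding dense_in_def set_eq_iff in_closure_of topspace_pointwise_topology[OF S]
    by blast
qed


section \<open>Counting\<close>

text \<open>For an infinite set, neither the product with a nonempty countable set nor passing to finite subsets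
  increases the cardinality.\<close>

lemma card_of_max_min_data:
  assumes "infinite P"
  shows "|max_min_data P| \<le>o |P|"
proof -
  have "|\<rat> :: real set| \<le>o |UNIV :: nat set|"
    using countable_rat unfolding countable_def card_of_ordLeq[symmetric] by auto
  also have "|UNIV :: nat set| \<le>o |P|"
    using assms by (simp add: infinite_iff_card_of_nat)
  finally have "|\<rat> :: real set| \<le>o |P|" .
  moreover have "(\<rat> :: real set) \<noteq> {}"
    using Rats_0 by blast
  ultimately have "|P \<times> (\<rat> :: real set)| =o |P|"
    using assms card_of_Times_infinite by blast
  moreover have inf: "infinite (P \<times> (\<rat> :: real set))"
    using assms Rats_0 by (auto dest: finite_cartesian_productD1)
  moreover have "|Fpow A| =o |A|" if "infinite A" for A :: "'c set"
    using eqpoll_Fpow[OF that] by (simp add: eqpoll_iff_card_of_ordIso)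
  ultimately have "|Fpow (Fpow (P \<times> (\<rat> :: real set)))| =o |P|"
    by (metis card_of_ordIso_finite ordIso_transitive)
  moreover have "max_min_data P \<subseteq> Fpow (Fpow (P \<times> \<rat>))"
    by (auto simp: max_min_data_def Fpow_def)
  ultimately show ?thesis
    using card_of_mono1 ordLeq_ordIso_trans by blast
qed

lemma infinite_dense_in_Hausdorff:
  assumes "Hausdorff_space X" "infinite (topspace X)" "dense_in X D"
  shows "infinite D"
  using assms closure_of_closedin[OF closedin_Hausdorff_finite[of X D]]
  unfolding dense_in_def by metis

lemma dense_in_stone_cech_image:
  assumes "dense_in X D"
  shows "dense_in (stone_cech X) (sc_embed X ` D)"
proof -
  let ?K = "stone_cech X"
  have dense: "?K closure_of (sc_embed X ` topspace X) = topspace ?K"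
    and sub: "sc_embed X ` topspace X \<subseteq> topspace ?K"
    using sc_embed_dense[of X] by (simp_all add: dense_in_def)
  have "continuous_map X ?K (sc_embed X)"
    unfolding stone_cech_def
    by (simp add: continuous_map_in_subtopology continuous_map_sc_embed_cube
        closure_of_subset[OF sc_embed_image_subset] flip: image_subset_iff_funcset)
  from continuous_map_image_closure_subset[OF this, of D] assms
  have "sc_embed X ` topspace X \<subseteq> ?K closure_of (sc_embed X ` D)"
    by (simp add: dense_in_def)
  from closure_of_mono[OF this, of ?K] have "topspace ?K \<subseteq> ?K closure_of (sc_embed X ` D)"
    using dense by simp
  then show ?thesis
    using assms sub closure_of_subset_topspace[of ?K "sc_embed X ` D"]
    unfolding dense_in_def by blast
qed

lemma top_density_le:
  assumes "dense_in Y D"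
  shows "top_density Y \<le>o |D|"
  using top_density_attained[of Y] assms by metis

theorem corollary3:
  fixes X :: "'a topology"
  assumes "completely_regular_space X" and "Hausdorff_space X"
    and "infinite (topspace X)"
  shows "top_density (pointwise_topology (stone_cech X) (O_set (stone_cech X))) \<le>o top_density X \<and>
    top_density (pointwise_topology (stone_cech X) (O_tau X)) \<le>o top_density X \<and>
    top_density (pointwise_topology (stone_cech X) (O_radon X)) \<le>o top_density X \<and>
    top_density (pointwise_topology (stone_cech X) (O_beta X)) \<le>o top_density X"
proof -
  let ?K = "stone_cech X"
  obtain D where D: "dense_in X D" "top_density X = |D|"
    using top_density_attained[of X] by blast
  define P where "P = sc_embed X ` D"
  define N where "N = max_min_functional ?K ` max_min_data P"
  have P: "dense_in ?K P"
    unfolding P_def by (rule dense_in_stone_cech_image[OF D(1)])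
  have PX: "P \<subseteq> sc_embed X ` topspace X"
    using D(1) by (auto simp: P_def dense_in_def)
  have "infinite D"
    using infinite_dense_in_Hausdorff assms D(1) by blast
  moreover have "inj_on (sc_embed X) D"
    using sc_embed_embedding[OF assms(1,2)] D(1)
    by (auto simp: dense_in_def embedding_map_def
        intro: inj_on_subset homeomorphic_imp_injective_map)
  ultimately have "infinite P"
    unfolding P_def by (simp add: finite_image_iff)
  have "|N| \<le>o |max_min_data P|"
    unfolding N_def by (rule card_of_image)
  also have "|max_min_data P| \<le>o |P|"
    using \<open>infinite P\<close> by (rule card_of_max_min_data)
  also have "|P| \<le>o |D|"
    unfolding P_def by (rule card_of_image)
  finally have card: "|N| \<le>o top_density X"
    by (simp add: D(2))
  have bound: "top_density (pointwise_topology ?K S) \<le>o top_density X"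
    if S: "S \<subseteq> O_set ?K" "N \<subseteq> S" for S
  proof -
    have "dense_in (pointwise_topology ?K S) N"
    proof (rule dense_in_pointwise_topologyI[OF S])
      fix \<mu> G and e :: real assume "\<mu> \<in> S" "finite G" "G \<subseteq> C_space ?K" "e > 0"
      then show "\<exists>\<nu>\<in>N. \<forall>f\<in>G. \<bar>\<nu> f - \<mu> f\<bar> < e"
        using max_min_functional_approximates[OF _ P, of \<mu> G e] S(1) by (auto simp: N_def)
    qed
    from top_density_le[OF this] card show ?thesis
      by (rule ordLeq_transitive)
  qed
  have "max_min_data P \<subseteq> max_min_data (sc_embed X ` topspace X)"
    using PX unfolding max_min_data_def by blast
  then have "N \<subseteq> O_tau X \<inter> O_radon X \<inter> O_beta X"
    unfolding N_def using max_min_functional_tau_radon_beta by blast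
  moreover have "O_tau X \<subseteq> O_set ?K" "O_radon X \<subseteq> O_set ?K" "O_beta X \<subseteq> O_set ?K"
    by (auto simp: O_tau_def O_radon_def O_beta_def)
  ultimately show ?thesis
    by (intro conjI bound) auto
qed

end
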